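(* Let $X$ be a topological space. Then $X$ is $e^*$-$R_1$ if and only if $e^*\text{-}cl_\theta(\{x\})=e^*\text{-}cl(\{x\})$ for all $x\in X$.
   Context: No separation axioms are assumed on topological spaces. For a subset $A$ of a topological space $X$, $cl(A)$ and $int(A)$ denote closure and interior, and $\delta\text{-}cl(A)=\{x\in X : int(cl(U))\cap A\neq\emptyset \text{ for every open } U \ni x\}$. $A$ is $e^*$-open if $A\subseteq cl(int(\delta\text{-}cl(A)))$; $e^*$-closed if its complement is $e^*$-open. $e^*\text{-}cl(A)$ is the intersection of all $e^*$-closed sets containing $A$. The $e^*$-$\theta$-closure of $A$ is $e^*\text{-}cl_\theta(A)=\{x\in X : e^*\text{-}cl(U)\cap A\neq\emptyset \text{ for every } e^*\text{-open } U\ni x\}$. The space $X$ is $e^*$-$R_1$ if for all $x,y\in X$ with $e^*\text{-}cl(\{x\})\neq e^*\text{-}cl(\{y\})$ there exist disjoint $e^*$-open sets $U$ and $V$ with $e^*\text{-}cl(\{x\})\subseteq U$ and $e^*\text{-}cl(\{y\})\subseteq V$. *)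

theory Defs
  imports "HOL-Analysis.Abstract_Topology"
begin

definition delta_cl :: "'a topology \<Rightarrow> 'a set \<Rightarrow> 'a set" where
  "delta_cl X A = {x \<in> topspace X.
     \<forall>U. openin X U \<and> x \<in> U \<longrightarrow> (X interior_of (X closure_of U)) \<inter> A \<noteq> {}}"

definition estar_open :: "'a topology \<Rightarrow> 'a set \<Rightarrow> bool" where
  "estar_open X A \<longleftrightarrow>
     A \<subseteq> topspace X \<and> A \<subseteq> X closure_of (X interior_of (delta_cl X A))"

definition estar_closed :: "'a topology \<Rightarrow> 'a set \<Rightarrow> bool" where
  "estar_closed X A \<longleftrightarrow> A \<subseteq> topspace X \<and> estar_open X (topspace X - A)"

(* Only meaningful for subsets A of the space, where topspace X itself belongs to the
   intersected family; for other A the family is empty and the result is UNIV. *)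
definition estar_cl :: "'a topology \<Rightarrow> 'a set \<Rightarrow> 'a set" where
  "estar_cl X A = \<Inter>{F. estar_closed X F \<and> A \<subseteq> F}"

definition estar_cl_theta :: "'a topology \<Rightarrow> 'a set \<Rightarrow> 'a set" where
  "estar_cl_theta X A = {x \<in> topspace X.
     \<forall>U. estar_open X U \<and> x \<in> U \<longrightarrow> estar_cl X U \<inter> A \<noteq> {}}"

definition estar_R1 :: "'a topology \<Rightarrow> bool" where
  "estar_R1 X \<longleftrightarrow>
     (\<forall>x \<in> topspace X. \<forall>y \<in> topspace X. estar_cl X {x} \<noteq> estar_cl X {y} \<longrightarrow>
        (\<exists>U V. estar_open X U \<and> estar_open X V \<and> U \<inter> V = {} \<and>
               estar_cl X {x} \<subseteq> U \<and> estar_cl X {y} \<subseteq> V))"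

end

theory Submission
  imports Defs
begin

text \<open>
  The only topological input is that arbitrary unions of \<open>e\<^sup>*\<close>-open sets are
  \<open>e\<^sup>*\<close>-open, which holds because the operator defining \<open>e\<^sup>*\<close>-openness is monotone.
  Hence \<open>e\<^sup>*\<close>-closures are \<open>e\<^sup>*\<close>-closed, and a point \<open>y\<close> lies in the closure of \<open>A\<close>
  iff every \<open>e\<^sup>*\<close>-open set around \<open>y\<close> meets \<open>A\<close>. From here on the
  argument is that for ordinary \<open>R\<^sub>1\<close> spaces.

  The point \<open>y\<close> lies outside \<open>e\<^sup>*-cl\<^sub>\<theta>({x})\<close> exactly when some \<open>e\<^sup>*\<close>-open \<open>U\<close> around
  \<open>y\<close> has \<open>x\<close> outside its closure, that is, when \<open>x\<close> and \<open>y\<close> have disjoint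
  \<open>e\<^sup>*\<close>-open neighbourhoods (\<open>estar_cl_theta_singleton_iff\<close>). This relation is symmetric
  in \<open>x\<close> and \<open>y\<close>. If the space is \<open>e\<^sup>*-R\<^sub>1\<close> and \<open>y\<close> is not in the closure of \<open>x\<close>, the
  two closures differ, so they are separated and hence so are the points. Conversely, if the two
  kinds of closure agree on points, then membership of \<open>y\<close> in the closure of \<open>x\<close> inherits
  the symmetry, and therefore every \<open>e\<^sup>*\<close>-open set contains the closure of each of its points
  (\<open>estar_cl_singleton_subset_open\<close>). Disjoint neighbourhoods of two points then
  automatically contain the closures of these points.
\<close>

lemma delta_cl_mono: "A \<subseteq> B \<Longrightarrow> delta_cl X A \<subseteq> delta_cl X B"
  unfolding delta_cl_def by blast

lemma estar_open_Union:
  assumes "\<And>A. A \<in> \<A> \<Longrightarrow> estar_open X A"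
  shows "estar_open X (\<Union>\<A>)"
  unfolding estar_open_def
proof (intro conjI Union_least)
  fix A assume A: "A \<in> \<A>"
  show "A \<subseteq> topspace X"
    using assms[OF A] by (simp add: estar_open_def)
  have "A \<subseteq> X closure_of (X interior_of (delta_cl X A))"
    using assms[OF A] by (simp add: estar_open_def)
  also have "\<dots> \<subseteq> X closure_of (X interior_of (delta_cl X (\<Union>\<A>)))"
    by (intro closure_of_mono interior_of_mono delta_cl_mono Union_upper A)
  finally show "A \<subseteq> X closure_of (X interior_of (delta_cl X (\<Union>\<A>)))" .
qed

lemma estar_closed_topspace: "estar_closed X (topspace X)"
  by (simp add: estar_closed_def estar_open_def)

lemma estar_closed_compl: "estar_open X U \<Longrightarrow> estar_closed X (topspace X - U)"
  by (simp add: estar_closed_def estar_open_def double_diff)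

lemma estar_cl_superset: "A \<subseteq> estar_cl X A"
  unfolding estar_cl_def by blast

lemma estar_cl_minimal: "estar_closed X F \<Longrightarrow> A \<subseteq> F \<Longrightarrow> estar_cl X A \<subseteq> F"
  unfolding estar_cl_def by blast

lemma estar_cl_subset_topspace: "A \<subseteq> topspace X \<Longrightarrow> estar_cl X A \<subseteq> topspace X"
  by (simp add: estar_cl_minimal estar_closed_topspace)

lemma estar_closed_estar_cl:
  assumes "A \<subseteq> topspace X"
  shows "estar_closed X (estar_cl X A)"
proof -
  have "topspace X - estar_cl X A
      = \<Union>((\<lambda>F. topspace X - F) ` {F. estar_closed X F \<and> A \<subseteq> F})"
    by (auto simp: estar_cl_def)
  also have "estar_open X \<dots>"
    by (rule estar_open_Union) (auto simp: estar_closed_def)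
  finally show ?thesis
    using estar_cl_subset_topspace[OF assms] by (simp add: estar_closed_def)
qed

lemma in_estar_cl_iff:
  assumes "A \<subseteq> topspace X" and "y \<in> topspace X"
  shows "y \<in> estar_cl X A \<longleftrightarrow> (\<forall>U. estar_open X U \<and> y \<in> U \<longrightarrow> U \<inter> A \<noteq> {})"
proof (intro iffI allI impI)
  fix U assume y: "y \<in> estar_cl X A" and U: "estar_open X U \<and> y \<in> U"
  show "U \<inter> A \<noteq> {}"
  proof
    assume "U \<inter> A = {}"
    then have "estar_cl X A \<subseteq> topspace X - U"
      using U assms(1) by (intro estar_cl_minimal estar_closed_compl) auto
    then show False
      using y U by blast
  qed
next
  assume meets: "\<forall>U. estar_open X U \<and> y \<in> U \<longrightarrow> U \<inter> A \<noteq> {}"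
  have "estar_open X (topspace X - estar_cl X A)"
    using estar_closed_estar_cl[OF assms(1)] by (simp add: estar_closed_def)
  then show "y \<in> estar_cl X A"
    using meets assms(2) estar_cl_superset[of A X] by blast
qed

lemma estar_cl_singleton_subset_theta:
  assumes "x \<in> topspace X"
  shows "estar_cl X {x} \<subseteq> estar_cl_theta X {x}"
proof
  fix y assume y: "y \<in> estar_cl X {x}"
  with assms have "y \<in> topspace X"
    using estar_cl_subset_topspace[of "{x}" X] by blast
  with y assms show "y \<in> estar_cl_theta X {x}"
    using estar_cl_superset[of _ X] by (fastforce simp: in_estar_cl_iff estar_cl_theta_def)
qed

text \<open>
  A point misses the closure of \<open>U\<close> exactly when it has an \<open>e\<^sup>*\<close>-open neighbourhood disjoint
  from \<open>U\<close>. Rewriting the definition this way exhibits membership in the \<open>\<theta>\<close>-closure of a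
  point as a symmetric relation between points.
\<close>

lemma estar_cl_theta_singleton_iff:
  assumes "x \<in> topspace X" and "y \<in> topspace X"
  shows "y \<in> estar_cl_theta X {x} \<longleftrightarrow>
    \<not> (\<exists>U V. estar_open X U \<and> estar_open X V \<and> U \<inter> V = {} \<and> x \<in> U \<and> y \<in> V)"
proof -
  have "x \<in> estar_cl X V \<longleftrightarrow> (\<forall>U. estar_open X U \<and> x \<in> U \<longrightarrow> U \<inter> V \<noteq> {})"
    if "estar_open X V" for V
    using that assms(1) by (intro in_estar_cl_iff) (simp_all add: estar_open_def)
  then show ?thesis
    using assms(2) unfolding estar_cl_theta_def by auto
qed

lemma estar_cl_theta_singleton_sym:
  assumes "x \<in> topspace X" and "y \<in> topspace X"
  shows "y \<in> estar_cl_theta X {x} \<longleftrightarrow> x \<in> estar_cl_theta X {y}"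
  using assms by (simp add: estar_cl_theta_singleton_iff) blast

text \<open>
  When the two closures of points agree and \<open>y\<close> is in the closure of \<open>x\<close>, symmetry of the \<open>\<theta>\<close>-relation
  puts \<open>x\<close> in the closure of \<open>y\<close>, so an \<open>e\<^sup>*\<close>-open set around \<open>x\<close> has to contain \<open>y\<close>.
\<close>

lemma estar_cl_singleton_subset_open:
  assumes theta: "\<And>z. z \<in> topspace X \<Longrightarrow> estar_cl_theta X {z} = estar_cl X {z}"
    and "estar_open X U" and "x \<in> U"
  shows "estar_cl X {x} \<subseteq> U"
proof
  fix y assume y: "y \<in> estar_cl X {x}"
  have x: "x \<in> topspace X"
    using assms(2,3) by (auto simp: estar_open_def)
  then have y_top: "y \<in> topspace X"
    using y estar_cl_subset_topspace[of "{x}" X] by blast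
  have "x \<in> estar_cl X {y}"
    using y estar_cl_theta_singleton_sym[OF x y_top] theta x y_top by simp
  then show "y \<in> U"
    using in_estar_cl_iff[of "{y}" X x] x y_top assms(2,3) by auto
qed

theorem theorem6p4:
  fixes X :: "'a topology"
  shows "estar_R1 X \<longleftrightarrow>
    (\<forall>x \<in> topspace X. estar_cl_theta X {x} = estar_cl X {x})"
proof
  assume R1: "estar_R1 X"
  show "\<forall>x \<in> topspace X. estar_cl_theta X {x} = estar_cl X {x}"
  proof (intro ballI antisym subsetI)
    fix x y assume x: "x \<in> topspace X" and y: "y \<in> estar_cl_theta X {x}"
    have y_top: "y \<in> topspace X"
      using y by (simp add: estar_cl_theta_def)
    show "y \<in> estar_cl X {x}"
    proof (rule ccontr)
      assume "y \<notin> estar_cl X {x}"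
      then have "estar_cl X {x} \<noteq> estar_cl X {y}"
        using estar_cl_superset[of "{y}" X] by blast
      then obtain U V where "estar_open X U" "estar_open X V" "U \<inter> V = {}"
        and "estar_cl X {x} \<subseteq> U" "estar_cl X {y} \<subseteq> V"
        using R1 x y_top unfolding estar_R1_def by blast
      moreover from this have "x \<in> U" "y \<in> V"
        using estar_cl_superset[of "{x}" X] estar_cl_superset[of "{y}" X] by blast+
      ultimately show False
        using y estar_cl_theta_singleton_iff[OF x y_top] by blast
    qed
  qed (auto dest: subsetD[OF estar_cl_singleton_subset_theta])
next
  assume "\<forall>x \<in> topspace X. estar_cl_theta X {x} = estar_cl X {x}"
  then have theta: "\<And>z. z \<in> topspace X \<Longrightarrow> estar_cl_theta X {z} = estar_cl X {z}"
    by blast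
  show "estar_R1 X"
    unfolding estar_R1_def
  proof (intro ballI impI)
    fix x y
    assume x: "x \<in> topspace X" and y: "y \<in> topspace X"
      and neq: "estar_cl X {x} \<noteq> estar_cl X {y}"
    have "y \<notin> estar_cl X {x}"
    proof
      assume yx: "y \<in> estar_cl X {x}"
      then have "x \<in> estar_cl X {y}"
        using estar_cl_theta_singleton_sym[OF x y] theta x y by simp
      with yx have "estar_cl X {x} = estar_cl X {y}"
        using x y by (intro antisym estar_cl_minimal estar_closed_estar_cl) auto
      with neq show False ..
    qed
    then obtain U V where "estar_open X U" "estar_open X V" "U \<inter> V = {}" "x \<in> U" "y \<in> V"
      using estar_cl_theta_singleton_iff[OF x y] theta[OF x] by blast
    then show "\<exists>U V. estar_open X U \<and> estar_open X V \<and> U \<inter> V = {} \<and>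
        estar_cl X {x} \<subseteq> U \<and> estar_cl X {y} \<subseteq> V"
      using estar_cl_singleton_subset_open[OF theta] by blast
  qed
qed

end
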